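(* Let $\lambda,\kappa\in\mathbb{R}$ with $\lambda\kappa<0$, and consider the periodic initial boundary value problem for the generalized Hunter-Saxton system (see context) with initial data such that $u_0'(x)$ and $\rho_0(x)$ are both bounded and, at least, $C^0[0,1]$ a.e. If $\rho_0(\alpha)$ never vanishes on $[0,1]$, then there exists a finite $t_\infty>0$ such that, as $t\uparrow t_\infty$, the solution components along characteristics converge to steady states: $$u_x(\gamma(\alpha,t),t)\to U_\infty(\alpha),\qquad \rho(\gamma(\alpha,t),t)\to P_\infty(\alpha),$$ where $$U_\infty(\alpha)=-\left(\frac{\mathcal{N}}{\mathcal{M}^{1+2\lambda}}+\frac{u_0'(\alpha)}{\rho_0(\alpha)}\,P_\infty(\alpha)\right),\qquad P_\infty(\alpha)=\frac{\rho_0(\alpha)}{C(\alpha)\mathcal{M}^{2\lambda}},$$ with $C(\alpha)=\lambda\left(\lambda u_0'(\alpha)^2-\kappa\rho_0(\alpha)^2\right)>0$ and the real numbers $\mathcal{M}>0$ and $\mathcal{N}$ defined by $$\mathcal{M}=\int_0^1\frac{d\alpha}{C(\alpha)^{\frac{1}{2\lambda}}},\qquad \mathcal{N}=\int_0^1\frac{u_0'(\alpha)}{C(\alpha)^{1+\frac{1}{2\lambda}}}\,d\alpha.$$ The same conclusion holds if $\lambda u_0'(\alpha_i)\le 0$ for all $\alpha_i\in[0,1]$, $1\le i\le n$, the (finitely many) locations where $\rho_0(\alpha)$ vanishes.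
   Context: The initial boundary value problem is $$u_{xt}+uu_{xx}-\lambda u_x^2-\kappa\rho^2=I(t),\qquad \rho_t+u\rho_x=2\lambda\rho u_x,\qquad t>0,$$ $$I(t)=-\kappa\int_0^1\rho^2\,dx-(1+\lambda)\int_0^1u_x^2\,dx,$$ with $u(x,0)=u_0(x)$, $\rho(x,0)=\rho_0(x)$ for $x\in[0,1]$, and periodic boundary conditions $u(0,t)=u(1,t)$, $u_x(0,t)=u_x(1,t)$, $\rho(0,t)=\rho(1,t)$; $u$ is assumed to have mean zero, $\int_0^1u\,dx\equiv0$. Characteristics: $\dot\gamma(\alpha,t)=u(\gamma(\alpha,t),t)$, $\gamma(\alpha,0)=\alpha$. The solution along characteristics is understood through the representation formulas (for $\lambda\ne0$): with $C(\alpha)=\lambda(\lambda u_0'(\alpha)^2-\kappa\rho_0(\alpha)^2)$, $\mathcal{Q}(\alpha,t)=C(\alpha)\eta(t)^2-2\lambda u_0'(\alpha)\eta(t)+1$, $\bar{\mathcal{P}}_0(t)=\int_0^1\mathcal{Q}(\alpha,t)^{-\frac1{2\lambda}}d\alpha$, and $\eta$ the strictly increasing solution of $\dot\eta=\bar{\mathcal{P}}_0^{-2\lambda}$, $\eta(0)=0$, $$u_x(\gamma(\alpha,t),t)=\frac{\bar{\mathcal{P}}_0(t)^{-2\lambda}}{\lambda}\left\{\frac{\lambda u_0'(\alpha)-\eta(t) C(\alpha)}{\mathcal{Q}(\alpha,t)}-\frac{1}{\bar{\mathcal{P}}_0(t)}\int_0^1\frac{\lambda u_0'(\alpha)-\eta(t)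 C(\alpha)}{\mathcal{Q}(\alpha,t)^{1+\frac1{2\lambda}}}d\alpha\right\},\qquad \rho(\gamma(\alpha,t),t)=\frac{\rho_0(\alpha)}{\mathcal{Q}(\alpha,t)}\bar{\mathcal{P}}_0(t)^{-2\lambda}.$$ Where $\rho_0(\alpha)=0$, the expression $\frac{u_0'(\alpha)}{\rho_0(\alpha)}P_\infty(\alpha)$ is read as $\frac{u_0'(\alpha)}{C(\alpha)\mathcal{M}^{2\lambda}}$. Standing assumptions: $\rho_0\not\equiv0$, and $C(\alpha)$ is not identically zero; $C(\alpha)>0$ is part of the definition of the steady states.
   Formalization: The sign of the N/M^{1+2λ} term in U_∞ is corrected (the printed sign fails unless N=0); at discontinuities of the data, vanishing of ρ0, λu0'≤0 and C>0 are read on all limit values; C>0 is assumed in the case where ρ0 has zeros. *)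

theory Defs
  imports "HOL-Analysis.Analysis"
begin

section \<open>Pointwise conditions on data that are only continuous almost everywhere\<close>

text \<open>All values that \<open>f\<close> takes or approaches at \<open>a\<close> from within \<open>[0,1]\<close>, one-sided limits at a
  jump included. Where \<open>f\<close> is continuous this is just \<open>{f a}\<close> (lemma below). Pointwise conditions
  such as ``\<open>\<rho>\<^sub>0\<close> vanishes at \<open>a\<close>'' are imposed on these values, because for merely
  a.e. continuous data the value at a single point carries no information: \<open>\<rho>\<^sub>0\<close> could
  tend to zero at \<open>a\<close> and be redefined there.\<close>

definition limit_values :: "(real \<Rightarrow> real) \<Rightarrow> real \<Rightarrow> real set" where
  "limit_values f a = {v. (a, v) \<in> closure ((\<lambda>x. (x, f x)) ` {0..1})}"

lemma limit_values_self: "a \<in> {0..1} \<Longrightarrow> f a \<in> limit_values f a"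
  unfolding limit_values_def by (auto intro!: closure_subset[THEN subsetD])

lemma limit_values_continuous:
  assumes a: "a \<in> {0..1}" and cont: "continuous (at a within {0..1}) f"
  shows "limit_values f a = {f a}"
proof -
  have "v = f a" if "v \<in> limit_values f a" for v
  proof -
    from that obtain s where s: "\<And>n. s n \<in> (\<lambda>x. (x, f x)) ` {0..1}" "s \<longlonglongrightarrow> (a, v)"
      unfolding limit_values_def closure_sequential by blast
    have in01: "fst (s n) \<in> {0..1}" and snd_eq: "snd (s n) = f (fst (s n))" for n
      using s(1)[of n] by auto
    have "(\<lambda>n. fst (s n)) \<longlonglongrightarrow> a"
      using tendsto_fst[OF s(2)] by simp
    then have "(\<lambda>n. f (fst (s n))) \<longlonglongrightarrow> f a"
      using cont in01 unfolding continuous_within_sequentially by (auto simp: o_def)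
    moreover have "(\<lambda>n. f (fst (s n))) \<longlonglongrightarrow> v"
      using tendsto_snd[OF s(2)] by (simp add: snd_eq)
    ultimately show ?thesis
      using LIMSEQ_unique by blast
  qed
  then show ?thesis
    using limit_values_self[OF a] by blast
qed

definition bounded_ae_continuous :: "(real \<Rightarrow> real) \<Rightarrow> bool" where
  "bounded_ae_continuous f \<longleftrightarrow>
     bounded (f ` {0..1}) \<and>
     negligible {x \<in> {0..1}. \<not> continuous (at x within {0..1}) f}"


section \<open>Initial data\<close>

text \<open>\<open>du0\<close> is \<open>u\<^sub>0'\<close>. The integral condition says that \<open>u0\<close> is a primitive of \<open>du0\<close>; in particular
  \<open>u0\<close> has derivative \<open>du0 x\<close> at every point \<open>x\<close> where \<open>du0\<close> is continuous.\<close>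

definition ghs_data :: "(real \<Rightarrow> real) \<Rightarrow> (real \<Rightarrow> real) \<Rightarrow> (real \<Rightarrow> real) \<Rightarrow> bool" where
  "ghs_data u0 du0 rho0 \<longleftrightarrow>
     bounded_ae_continuous du0 \<and> bounded_ae_continuous rho0 \<and>
     (\<forall>x\<in>{0..1}. (du0 has_integral (u0 x - u0 0)) {0..x}) \<and>
     u0 0 = u0 1 \<and> du0 0 = du0 1 \<and> rho0 0 = rho0 1 \<and>
     integral {0..1} u0 = 0"


section \<open>Representation formulas along characteristics\<close>

definition ghs_C :: "real \<Rightarrow> real \<Rightarrow> (real \<Rightarrow> real) \<Rightarrow> (real \<Rightarrow> real) \<Rightarrow> real \<Rightarrow> real" where
  "ghs_C lam kap du0 rho0 \<alpha> = lam * (lam * (du0 \<alpha>)\<^sup>2 - kap * (rho0 \<alpha>)\<^sup>2)"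

text \<open>In the next two definitions \<open>h\<close> is the value \<open>\<eta>(t)\<close>.\<close>

definition ghs_Q ::
    "real \<Rightarrow> real \<Rightarrow> (real \<Rightarrow> real) \<Rightarrow> (real \<Rightarrow> real) \<Rightarrow> real \<Rightarrow> real \<Rightarrow> real" where
  "ghs_Q lam kap du0 rho0 h \<alpha> =
     ghs_C lam kap du0 rho0 \<alpha> * h\<^sup>2 - 2 * lam * du0 \<alpha> * h + 1"

definition ghs_P0 :: "real \<Rightarrow> real \<Rightarrow> (real \<Rightarrow> real) \<Rightarrow> (real \<Rightarrow> real) \<Rightarrow> real \<Rightarrow> real" where
  "ghs_P0 lam kap du0 rho0 h =
     integral {0..1} (\<lambda>\<alpha>. ghs_Q lam kap du0 rho0 h \<alpha> powr (- (1 / (2 * lam))))"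

definition ghs_eta ::
    "real \<Rightarrow> real \<Rightarrow> (real \<Rightarrow> real) \<Rightarrow> (real \<Rightarrow> real) \<Rightarrow> real \<Rightarrow> (real \<Rightarrow> real) \<Rightarrow> bool" where
  "ghs_eta lam kap du0 rho0 T eta \<longleftrightarrow>
     eta 0 = 0 \<and> strict_mono_on {0..<T} eta \<and>
     (\<forall>t\<in>{0..<T}. (eta has_real_derivative ghs_P0 lam kap du0 rho0 (eta t) powr (- 2 * lam))
        (at t within {0..<T}))"

text \<open>The right-hand sides of the formulas for \<open>u\<^sub>x(\<gamma>(\<alpha>,t),t)\<close> and \<open>\<rho>(\<gamma>(\<alpha>,t),t)\<close>.\<close>

definition ghs_ux_char ::
    "real \<Rightarrow> real \<Rightarrow> (real \<Rightarrow> real) \<Rightarrow> (real \<Rightarrow> real) \<Rightarrow> (real \<Rightarrow> real) \<Rightarrow> real \<Rightarrow> real \<Rightarrow> real" where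
  "ghs_ux_char lam kap du0 rho0 eta \<alpha> t =
     (let C = ghs_C lam kap du0 rho0; Q = ghs_Q lam kap du0 rho0 (eta t);
          P0 = ghs_P0 lam kap du0 rho0 (eta t)
      in P0 powr (- 2 * lam) / lam *
           ((lam * du0 \<alpha> - eta t * C \<alpha>) / Q \<alpha> -
            1 / P0 * integral {0..1}
              (\<lambda>\<beta>. (lam * du0 \<beta> - eta t * C \<beta>) / Q \<beta> powr (1 + 1 / (2 * lam)))))"

definition ghs_rho_char ::
    "real \<Rightarrow> real \<Rightarrow> (real \<Rightarrow> real) \<Rightarrow> (real \<Rightarrow> real) \<Rightarrow> (real \<Rightarrow> real) \<Rightarrow> real \<Rightarrow> real \<Rightarrow> real" where
  "ghs_rho_char lam kap du0 rho0 eta \<alpha> t =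
     rho0 \<alpha> / ghs_Q lam kap du0 rho0 (eta t) \<alpha> *
     ghs_P0 lam kap du0 rho0 (eta t) powr (- 2 * lam)"


section \<open>The initial boundary value problem\<close>

definition ghs_I ::
    "real \<Rightarrow> real \<Rightarrow> (real \<Rightarrow> real \<Rightarrow> real) \<Rightarrow> (real \<Rightarrow> real \<Rightarrow> real) \<Rightarrow> real \<Rightarrow> real" where
  "ghs_I lam kap ux rho t =
     - kap * integral {0..1} (\<lambda>x. (rho x t)\<^sup>2) - (1 + lam) * integral {0..1} (\<lambda>x. (ux x t)\<^sup>2)"

text \<open>A solution on \<open>[0,T)\<close> with \<open>u\<close>, \<open>ux\<close> (standing for \<open>u\<^sub>x\<close>) and \<open>rho\<close> extended
  \<open>1\<close>-periodically in \<open>x\<close>, since characteristics may leave \<open>[0,1]\<close>, and \<open>gamma \<alpha> t\<close> the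
  characteristic starting at \<open>\<alpha>\<close>. For the admitted data \<open>u\<^sub>x\<^sub>x\<close> and \<open>\<rho>\<^sub>x\<close> need not exist, so the two
  equations are stated along characteristics, where their left-hand sides
  \<open>u\<^sub>x\<^sub>t + u u\<^sub>x\<^sub>x\<close> and \<open>\<rho>\<^sub>t + u \<rho>\<^sub>x\<close> are the time derivatives of \<open>u\<^sub>x(\<gamma>(\<alpha>,t),t)\<close> and \<open>\<rho>(\<gamma>(\<alpha>,t),t)\<close>.
  The values along characteristics are those of the representation formulas.\<close>

definition ghs_solution ::
    "real \<Rightarrow> real \<Rightarrow> (real \<Rightarrow> real) \<Rightarrow> (real \<Rightarrow> real) \<Rightarrow> (real \<Rightarrow> real) \<Rightarrow> real \<Rightarrow>
     (real \<Rightarrow> real \<Rightarrow> real) \<Rightarrow> (real \<Rightarrow> real \<Rightarrow> real) \<Rightarrow> (real \<Rightarrow> real \<Rightarrow> real) \<Rightarrow>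
     (real \<Rightarrow> real \<Rightarrow> real) \<Rightarrow> bool" where
  "ghs_solution lam kap u0 du0 rho0 T u ux rho gamma \<longleftrightarrow>
     (\<forall>x\<in>{0..1}. u x 0 = u0 x \<and> rho x 0 = rho0 x) \<and>
     (\<forall>t\<in>{0..<T}. \<forall>x. u (x + 1) t = u x t \<and> ux (x + 1) t = ux x t \<and> rho (x + 1) t = rho x t) \<and>
     (\<forall>t\<in>{0..<T}. integral {0..1} (\<lambda>x. u x t) = 0) \<and>
     (\<forall>t\<in>{0..<T}. \<forall>a b. a \<le> b \<longrightarrow> ((\<lambda>x. ux x t) has_integral (u b t - u a t)) {a..b}) \<and>
     (\<forall>\<alpha>\<in>{0..1}. gamma \<alpha> 0 = \<alpha> \<and>
        (\<forall>t\<in>{0..<T}.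
           ((\<lambda>s. gamma \<alpha> s) has_real_derivative u (gamma \<alpha> t) t) (at t within {0..<T}) \<and>
           ((\<lambda>s. ux (gamma \<alpha> s) s) has_real_derivative
              lam * (ux (gamma \<alpha> t) t)\<^sup>2 + kap * (rho (gamma \<alpha> t) t)\<^sup>2 + ghs_I lam kap ux rho t)
              (at t within {0..<T}) \<and>
           ((\<lambda>s. rho (gamma \<alpha> s) s) has_real_derivative
              2 * lam * rho (gamma \<alpha> t) t * ux (gamma \<alpha> t) t) (at t within {0..<T}))) \<and>
     (\<exists>eta. ghs_eta lam kap du0 rho0 T eta \<and>
        (\<forall>\<alpha>\<in>{0..1}. \<forall>t\<in>{0..<T}.
           ux (gamma \<alpha> t) t = ghs_ux_char lam kap du0 rho0 eta \<alpha> t \<and>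
           rho (gamma \<alpha> t) t = ghs_rho_char lam kap du0 rho0 eta \<alpha> t))"


section \<open>Steady states\<close>

definition ghs_M :: "real \<Rightarrow> real \<Rightarrow> (real \<Rightarrow> real) \<Rightarrow> (real \<Rightarrow> real) \<Rightarrow> real" where
  "ghs_M lam kap du0 rho0 =
     integral {0..1} (\<lambda>\<alpha>. 1 / ghs_C lam kap du0 rho0 \<alpha> powr (1 / (2 * lam)))"

definition ghs_N :: "real \<Rightarrow> real \<Rightarrow> (real \<Rightarrow> real) \<Rightarrow> (real \<Rightarrow> real) \<Rightarrow> real" where
  "ghs_N lam kap du0 rho0 =
     integral {0..1} (\<lambda>\<alpha>. du0 \<alpha> / ghs_C lam kap du0 rho0 \<alpha> powr (1 + 1 / (2 * lam)))"

definition ghs_P_inf :: "real \<Rightarrow> real \<Rightarrow> (real \<Rightarrow> real) \<Rightarrow> (real \<Rightarrow> real) \<Rightarrow> real \<Rightarrow> real" where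
  "ghs_P_inf lam kap du0 rho0 \<alpha> =
     rho0 \<alpha> / (ghs_C lam kap du0 rho0 \<alpha> * ghs_M lam kap du0 rho0 powr (2 * lam))"

text \<open>The conditional is the reading of \<open>(u\<^sub>0'/\<rho>\<^sub>0) P\<^sub>\<infinity>\<close> at zeros of \<open>\<rho>\<^sub>0\<close>.

  The source prints the bracket as \<open>\<N> / \<M>\<^sup>1\<^sup>+\<^sup>2\<^sup>\<lambda> + (u\<^sub>0'/\<rho>\<^sub>0) P\<^sub>\<infinity>\<close>. With its own definitions
  of \<open>\<M>\<close>, \<open>\<N>\<close>, \<open>P\<^sub>\<infinity>\<close> the limit of the representation formula carries the opposite sign on the
  first term, and so does the mean-zero condition \<open>\<integral> u\<^sub>x dx = 0\<close>: the limiting Jacobian of the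
  characteristics is \<open>C\<^sup>-\<^sup>1\<^sup>/\<^sup>(\<^sup>2\<^sup>\<lambda>\<^sup>) / \<M>\<close>, and lemma \<open>ghs_U_inf_mean_zero\<close> below fails for
  the printed sign unless \<open>\<N> = 0\<close>. The sign is therefore corrected here.\<close>

definition ghs_U_inf :: "real \<Rightarrow> real \<Rightarrow> (real \<Rightarrow> real) \<Rightarrow> (real \<Rightarrow> real) \<Rightarrow> real \<Rightarrow> real" where
  "ghs_U_inf lam kap du0 rho0 \<alpha> =
     - (- (ghs_N lam kap du0 rho0 / ghs_M lam kap du0 rho0 powr (1 + 2 * lam)) +
        (if rho0 \<alpha> = 0
         then du0 \<alpha> / (ghs_C lam kap du0 rho0 \<alpha> * ghs_M lam kap du0 rho0 powr (2 * lam))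
         else du0 \<alpha> / rho0 \<alpha> * ghs_P_inf lam kap du0 rho0 \<alpha>))"

lemma ghs_U_inf_mean_zero:
  assumes C: "\<And>\<alpha>. \<alpha> \<in> {0..1} \<Longrightarrow> 0 < ghs_C lam kap du0 rho0 \<alpha>"
    and M: "0 < ghs_M lam kap du0 rho0"
    and iM: "(\<lambda>\<alpha>. 1 / ghs_C lam kap du0 rho0 \<alpha> powr (1 / (2 * lam))) integrable_on {0..1}"
    and iN: "(\<lambda>\<alpha>. du0 \<alpha> / ghs_C lam kap du0 rho0 \<alpha> powr (1 + 1 / (2 * lam))) integrable_on {0..1}"
  shows "integral {0..1} (\<lambda>\<alpha>. ghs_U_inf lam kap du0 rho0 \<alpha> *
           (1 / ghs_C lam kap du0 rho0 \<alpha> powr (1 / (2 * lam)))) = 0"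
proof -
  let ?C = "ghs_C lam kap du0 rho0" and ?M = "ghs_M lam kap du0 rho0"
    and ?N = "ghs_N lam kap du0 rho0"
  have "((\<lambda>\<alpha>. ?N / ?M powr (1 + 2 * lam) * (1 / ?C \<alpha> powr (1 / (2 * lam))) -
          1 / ?M powr (2 * lam) * (du0 \<alpha> / ?C \<alpha> powr (1 + 1 / (2 * lam)))) has_integral
        (?N / ?M powr (1 + 2 * lam) * ?M - 1 / ?M powr (2 * lam) * ?N)) {0..1}"
    using iM iN unfolding ghs_M_def ghs_N_def
    by (intro has_integral_diff has_integral_mult_right integrable_integral)
  moreover have "?N / ?M powr (1 + 2 * lam) * ?M - 1 / ?M powr (2 * lam) * ?N = 0"
    using M by (simp add: powr_add)
  moreover have "?N / ?M powr (1 + 2 * lam) * (1 / ?C \<alpha> powr (1 / (2 * lam))) -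
          1 / ?M powr (2 * lam) * (du0 \<alpha> / ?C \<alpha> powr (1 + 1 / (2 * lam))) =
        ghs_U_inf lam kap du0 rho0 \<alpha> * (1 / ?C \<alpha> powr (1 / (2 * lam)))"
    if "\<alpha> \<in> {0..1}" for \<alpha>
    using C[OF that] by (auto simp: ghs_U_inf_def ghs_P_inf_def powr_add field_simps)
  ultimately have "((\<lambda>\<alpha>. ghs_U_inf lam kap du0 rho0 \<alpha> *
           (1 / ?C \<alpha> powr (1 / (2 * lam)))) has_integral 0) {0..1}"
    using has_integral_cong by (smt (verit))
  then show ?thesis
    by (rule integral_unique)
qed

end

theory Submission
  imports Defs
begin

text \<open>
  The substitution \<open>\<eta> = tan \<theta>\<close> compactifies the range \<open>[0, \<infinity>)\<close> of \<open>\<eta>\<close>. It turns \<open>\<Q>\<close> into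
  \<open>R / cos\<^sup>2 \<theta>\<close>, where
  \<open>R(\<theta>) = C sin\<^sup>2 \<theta> - 2 \<lambda> u\<^sub>0' sin \<theta> cos \<theta> + cos\<^sup>2 \<theta>
        = (cos \<theta> - \<lambda> u\<^sub>0' sin \<theta>)\<^sup>2 - \<lambda> \<kappa> \<rho>\<^sub>0\<^sup>2 sin\<^sup>2 \<theta>\<close>.
  Since \<open>\<lambda> \<kappa> < 0\<close>, both summands are nonnegative, and they vanish together for some
  \<open>\<theta> \<in> [0, \<pi>/2]\<close> only if \<open>\<rho>\<^sub>0 = 0\<close> and \<open>\<lambda> u\<^sub>0' \<ge> 0\<close>. The hypotheses exclude this not only for the
  values of the data but for all their limit values, and these form a compact set \<open>K\<close>
  (\<open>ghs_form_compact_range\<close>). So \<open>R\<close> is continuous and positive on the compact set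
  \<open>[0, \<pi>/2] \<times> K\<close>, and every integral in the representation formulas becomes a continuous function
  of \<open>\<theta>\<close> on the closed interval \<open>[0, \<pi>/2]\<close> (\<open>continuous_on_integral_compose\<close>). At \<open>\<theta> = \<pi>/2\<close>,
  that is \<open>\<eta> = \<infinity>\<close>, \<open>R\<close> equals \<open>C\<close>.

  With \<open>J(\<theta>) = \<integral> R(\<theta>)\<^sup>-\<^sup>1\<^sup>/\<^sup>(\<^sup>2\<^sup>\<lambda>\<^sup>)\<close> the equation for \<open>\<eta>\<close> becomes \<open>\<theta>' = J(\<theta>)\<^sup>-\<^sup>2\<^sup>\<lambda>\<close>. Its speed is continuous
  and bounded away from \<open>0\<close> on \<open>[0, \<pi>/2]\<close>, so \<open>\<theta>\<close> reaches \<open>\<pi>/2\<close> at the finite time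
  \<open>t\<^sub>\<infinity> = \<integral> J(\<theta>)\<^sup>2\<^sup>\<lambda> d\<theta>\<close>, the integral taken over \<open>[0, \<pi>/2]\<close> (\<open>autonomous_flow_hits_end\<close>,
  \<open>angle_clock\<close>).

  It remains to take \<open>\<theta> \<rightarrow> \<pi>/2\<close> in the formulas. In the one for \<open>u\<^sub>x\<close> both terms in the
  braces tend to zero only like \<open>cos \<theta>\<close> while the prefactor grows like \<open>1 / cos\<^sup>2 \<theta>\<close>. But the
  leading part of the first term is \<open>- cos \<theta> / sin \<theta>\<close>, which does not depend on \<open>\<alpha>\<close>. The second
  term is the mean of the first with weight \<open>\<Q>\<^sup>-\<^sup>1\<^sup>/\<^sup>(\<^sup>2\<^sup>\<lambda>\<^sup>)\<close>, so it contains the same constant, the two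
  cancel, and what is left carries the factor \<open>cos\<^sup>2 \<theta>\<close> needed (\<open>ux_char_tan\<close>).
\<close>

section \<open>Integrals of functions that are continuous almost everywhere\<close>

text \<open>Measurability comes from continuity off a null set, integrability from boundedness on a bounded
  interval.\<close>

lemma bounded_ae_continuous_absolutely_integrable:
  assumes "bounded_ae_continuous f"
  shows "f absolutely_integrable_on {0..1}"
proof -
  define N where "N = {x \<in> {0..1}. \<not> continuous (at x within {0..1}) f}"
  from assms obtain B where N: "negligible N" and B: "\<And>x. x \<in> {0..1} \<Longrightarrow> norm (f x) \<le> B"
    unfolding bounded_ae_continuous_def N_def bounded_iff by blast
  have S: "{0..1} - N \<in> sets lebesgue"
    using N by (intro sets.Diff) (auto simp: negligible_iff_null_sets null_setsD2)
  have "continuous_on ({0..1} - N) f"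
    unfolding continuous_on_eq_continuous_within N_def
    by (auto intro: continuous_within_subset)
  then have "f \<in> borel_measurable (lebesgue_on ({0..1} - N))"
    using S by (rule continuous_imp_measurable_on_sets_lebesgue)
  moreover have "(\<lambda>_. B) integrable_on ({0..1} - N)"
    by (rule integrable_spike_set[of _ "{0..1}"])
      (auto intro: negligible_subset[OF N])
  ultimately have "f absolutely_integrable_on ({0..1} - N)"
    using S B by (intro measurable_bounded_by_integrable_imp_absolutely_integrable) auto
  moreover have "f absolutely_integrable_on ({0..1} - N) \<longleftrightarrow> f absolutely_integrable_on {0..1}"
    by (rule absolutely_integrable_spike_set_eq) (auto intro: negligible_subset[OF N])
  ultimately show ?thesis
    by simp
qed

text \<open>Such data are kept by composition with a continuous function of the pair, so every integrand
  below is of the same kind as the data and needs no separate measurability argument.\<close>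

lemma bounded_ae_continuous_compose:
  fixes \<phi> :: "real \<times> real \<Rightarrow> real"
  assumes f: "bounded_ae_continuous f" and g: "bounded_ae_continuous g"
    and K: "compact K" "\<And>x. x \<in> {0..1} \<Longrightarrow> (f x, g x) \<in> K"
    and \<phi>: "continuous_on K \<phi>"
  shows "bounded_ae_continuous (\<lambda>x. \<phi> (f x, g x))"
  unfolding bounded_ae_continuous_def
proof
  have "bounded (\<phi> ` K)"
    using K(1) \<phi> by (intro compact_imp_bounded compact_continuous_image)
  then show "bounded ((\<lambda>x. \<phi> (f x, g x)) ` {0..1})"
    by (rule bounded_subset) (use K(2) in auto)
  have "continuous (at x within {0..1}) (\<lambda>x. \<phi> (f x, g x))"
    if x: "x \<in> {0..1}" and cf: "continuous (at x within {0..1}) f"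
      and cg: "continuous (at x within {0..1}) g" for x
  proof -
    have "((\<lambda>y. (f y, g y)) \<longlongrightarrow> (f x, g x)) (at x within {0..1})"
      using cf cg by (intro tendsto_Pair) (auto simp: continuous_within)
    moreover have "\<forall>\<^sub>F y in at x within {0..1}. (f y, g y) \<in> K"
      unfolding eventually_at_filter using K(2) by (auto intro!: always_eventually)
    ultimately show ?thesis
      unfolding continuous_within using continuous_on_tendsto_compose[OF \<phi>] K(2)[OF x] by blast
  qed
  then have "{x \<in> {0..1}. \<not> continuous (at x within {0..1}) (\<lambda>x. \<phi> (f x, g x))} \<subseteq>
      {x \<in> {0..1}. \<not> continuous (at x within {0..1}) f} \<union>
      {x \<in> {0..1}. \<not> continuous (at x within {0..1}) g}"
    by blast
  then show "negligible {x \<in> {0..1}. \<not> continuous (at x within {0..1}) (\<lambda>x. \<phi> (f x, g x))}"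
    using f g unfolding bounded_ae_continuous_def
    by (meson negligible_Un negligible_subset)
qed

text \<open>On a compact product \<open>\<Phi>\<close> is uniformly continuous, so a small change of the parameter changes
  the integrand uniformly little. Compactness of \<open>K\<close> makes up for the discontinuities of
  \<open>f\<close> and \<open>g\<close>.\<close>

lemma continuous_on_integral_compose:
  fixes \<Phi> :: "'a::metric_space \<Rightarrow> real \<times> real \<Rightarrow> real"
  assumes f: "bounded_ae_continuous f" and g: "bounded_ae_continuous g"
    and K: "compact K" "\<And>x. x \<in> {0..1} \<Longrightarrow> (f x, g x) \<in> K"
    and \<Phi>: "continuous_on (S \<times> K) (\<lambda>(s, z). \<Phi> s z)" and S: "compact S"
  shows "continuous_on S (\<lambda>s. integral {0..1} (\<lambda>x. \<Phi> s (f x, g x)))"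
  unfolding continuous_on_iff
proof safe
  fix s and e :: real assume s: "s \<in> S" and e: "0 < e"
  have "uniformly_continuous_on (S \<times> K) (\<lambda>(s, z). \<Phi> s z)"
    using \<Phi> S K(1) by (intro compact_uniformly_continuous compact_Times)
  then obtain d where d: "0 < d" and D:
    "\<And>p q. p \<in> S \<times> K \<Longrightarrow> q \<in> S \<times> K \<Longrightarrow> dist q p < d \<Longrightarrow>
      dist (case q of (s, z) \<Rightarrow> \<Phi> s z) (case p of (s, z) \<Rightarrow> \<Phi> s z) < e / 2"
    using e by (auto elim!: uniformly_continuous_onE[of _ _ "e / 2"])
  have int: "(\<lambda>x. \<Phi> r (f x, g x)) integrable_on {0..1}" if "r \<in> S" for r
  proof -
    have "continuous_on K (\<Phi> r)"
      using continuous_on_compose2[OF \<Phi>, of K "\<lambda>z. (r, z)"] that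
      by (force intro!: continuous_intros)
    then show ?thesis
      using bounded_ae_continuous_absolutely_integrable[OF bounded_ae_continuous_compose[OF f g K]]
      by (simp add: absolutely_integrable_on_def)
  qed
  have "dist (integral {0..1} (\<lambda>x. \<Phi> r (f x, g x))) (integral {0..1} (\<lambda>x. \<Phi> s (f x, g x))) < e"
    if r: "r \<in> S" "dist r s < d" for r
  proof -
    have "norm (integral {0..1} (\<lambda>x. \<Phi> r (f x, g x) - \<Phi> s (f x, g x)))
        \<le> e / 2 * measure lborel (cbox (0::real) 1)"
    proof (rule has_integral_bound)
      show "((\<lambda>x. \<Phi> r (f x, g x) - \<Phi> s (f x, g x)) has_integral
          integral {0..1} (\<lambda>x. \<Phi> r (f x, g x) - \<Phi> s (f x, g x))) (cbox 0 1)"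
        using integrable_diff[OF int[OF r(1)] int[OF s]] by (simp add: integrable_integral)
      show "norm (\<Phi> r (f x, g x) - \<Phi> s (f x, g x)) \<le> e / 2" if "x \<in> cbox 0 1" for x
        using D[of "(s, f x, g x)" "(r, f x, g x)"] r s K(2)[of x] that
        by (auto simp: dist_Pair_Pair dist_real_def)
    qed (use e in simp)
    then show ?thesis
      using e integral_diff[OF int[OF r(1)] int[OF s]] by (simp add: dist_real_def)
  qed
  with d show "\<exists>d>0. \<forall>r\<in>S. dist r s < d \<longrightarrow>
      dist (integral {0..1} (\<lambda>x. \<Phi> r (f x, g x))) (integral {0..1} (\<lambda>x. \<Phi> s (f x, g x))) < e"
    by blast
qed

section \<open>Time to cross an interval\<close>

text \<open>The solution of \<open>y' = 1 / f(y)\<close> is the inverse of \<open>\<tau>(x) = \<integral>\<^sub>0\<^sup>x f\<close>, the time needed to reach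
  \<open>x\<close>; hence \<open>T = \<tau>(b)\<close>. It is unique although \<open>f\<close> is merely continuous, because
  \<open>\<tau>(y(t)) - t\<close> is constant along every solution \<open>y\<close>.\<close>

lemma autonomous_flow_hits_end:
  fixes f :: "real \<Rightarrow> real"
  assumes b: "0 < b" and cont: "continuous_on {0..b} f" and pos: "\<And>x. x \<in> {0..b} \<Longrightarrow> 0 < f x"
  obtains g T where "0 < T" "g 0 = 0" "g T = b" "strict_mono_on {0..T} g"
    and "\<And>t. t \<in> {0..T} \<Longrightarrow> g t \<in> {0..b}"
    and "\<And>t. t \<in> {0..T} \<Longrightarrow> (g has_real_derivative inverse (f (g t))) (at t within {0..T})"
    and "\<And>y t. y 0 = 0 \<Longrightarrow> (\<And>s. s \<in> {0..<T} \<Longrightarrow> y s \<in> {0..b} \<and>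
          (y has_real_derivative inverse (f (y s))) (at s within {0..<T})) \<Longrightarrow>
        t \<in> {0..<T} \<Longrightarrow> y t = g t"
proof -
  define \<tau> where "\<tau> x = integral {0..x} f" for x
  define T where "T = \<tau> b"
  have d\<tau>: "(\<tau> has_real_derivative f x) (at x within {0..b})" if "x \<in> {0..b}" for x
    unfolding \<tau>_def using cont that by (rule integral_has_real_derivative)
  have c\<tau>: "continuous_on {0..b} \<tau>"
    using d\<tau> DERIV_continuous unfolding continuous_on_eq_continuous_within by blast
  have mono: "\<tau> x < \<tau> y" if "0 \<le> x" "x < y" "y \<le> b" for x y
  proof (rule DERIV_pos_imp_increasing_open[OF that(2)])
    show "\<exists>z. DERIV \<tau> w :> z \<and> 0 < z" if "x < w" "w < y" for w
      using d\<tau>[of w] pos[of w] at_within_Icc_at[of 0 w b] that \<open>0 \<le> x\<close> \<open>y \<le> b\<close> by auto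
    show "continuous_on {x..y} \<tau>"
      by (rule continuous_on_subset[OF c\<tau>]) (use that in auto)
  qed
  have \<tau>0: "\<tau> 0 = 0"
    by (simp add: \<tau>_def)
  have T: "0 < T"
    using mono[of 0 b] b \<tau>0 by (simp add: T_def)
  have le: "\<tau> x \<le> \<tau> y" if "0 \<le> x" "x \<le> y" "y \<le> b" for x y
    using mono[of x y] that by (cases "x = y") auto
  have inj: "inj_on \<tau> {0..b}"
    by (rule linorder_inj_onI) (use mono in \<open>force+\<close>)
  define g where "g = the_inv_into {0..b} \<tau>"
  have g\<tau>: "g (\<tau> x) = x" if "x \<in> {0..b}" for x
    unfolding g_def using inj that by (rule the_inv_into_f_f)
  have im: "\<tau> ` {0..b} = {0..T}"
  proof
    show "\<tau> ` {0..b} \<subseteq> {0..T}"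
      using le[of 0] le[of _ b] \<tau>0 by (auto simp: T_def)
    show "{0..T} \<subseteq> \<tau> ` {0..b}"
      using IVT'[of \<tau> 0 _ b] \<tau>0 c\<tau> b by (force simp: T_def)
  qed
  have ex: "\<exists>x\<in>{0..b}. t = \<tau> x" if "t \<in> {0..T}" for t
    using that im by blast
  have cg: "continuous_on {0..T} g"
    using continuous_on_inv[OF c\<tau>, of g] g\<tau> im by auto
  show thesis
  proof (rule that)
    show "0 < T" by fact
    show "g 0 = 0" "g T = b"
      using g\<tau>[of 0] g\<tau>[of b] b \<tau>0 by (auto simp: T_def)
    show "g t \<in> {0..b}" if "t \<in> {0..T}" for t
      using ex[OF that] g\<tau> by auto
    show "strict_mono_on {0..T} g"
    proof (rule strict_mono_onI)
      fix s t assume st: "s \<in> {0..T}" "t \<in> {0..T}" "s < t"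
      obtain x y where xy: "x \<in> {0..b}" "s = \<tau> x" "y \<in> {0..b}" "t = \<tau> y"
        using ex st by metis
      then show "g s < g t"
        using le[of y x] st(3) g\<tau> by fastforce
    qed
    show "(g has_real_derivative inverse (f (g t))) (at t within {0..T})" if t: "t \<in> {0..T}" for t
    proof -
      obtain x where x: "x \<in> {0..b}" "t = \<tau> x"
        using ex[OF t] by blast
      have "(g has_derivative (*) (inverse (f x))) (at (\<tau> x) within \<tau> ` {0..b})"
      proof (rule has_derivative_inverse_within)
        show "(\<tau> has_derivative (*) (f x)) (at x within {0..b})"
          using d\<tau>[OF x(1)] by (simp add: has_field_derivative_def)
        show "continuous (at (\<tau> x) within \<tau> ` {0..b}) g"
          using cg t x unfolding im continuous_on_eq_continuous_within by blast
        show "(*) (inverse (f x)) \<circ> (*) (f x) = id"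
          using pos[OF x(1)] by (auto simp: fun_eq_iff)
      qed (use x g\<tau> in \<open>auto intro: linear_times\<close>)
      then show ?thesis
        using x g\<tau> im by (simp add: has_field_derivative_def)
    qed
    show "y t = g t" if y0: "y 0 = 0" and y: "\<And>t. t \<in> {0..<T} \<Longrightarrow> y t \<in> {0..b} \<and>
          (y has_real_derivative inverse (f (y t))) (at t within {0..<T})" and t: "t \<in> {0..<T}"
      for y t
    proof -
      have "\<exists>c. \<forall>s\<in>{0..<T}. \<tau> (y s) - s = c"
      proof (rule has_field_derivative_zero_constant)
        fix s assume s: "s \<in> {0..<T}"
        have "(\<tau> has_real_derivative f (y s)) (at (y s) within y ` {0..<T})"
          by (rule DERIV_subset[OF d\<tau>]) (use y[OF s] in blast, use y in blast)
        then have "(\<tau> \<circ> y has_real_derivative f (y s) * inverse (f (y s))) (at s within {0..<T})"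
          using y[OF s] by (intro DERIV_image_chain) auto
        moreover have "f (y s) * inverse (f (y s)) = 1"
          using pos[of "y s"] y[OF s] by simp
        ultimately show "((\<lambda>s. \<tau> (y s) - s) has_real_derivative 0) (at s within {0..<T})"
          by (auto simp: o_def intro!: derivative_eq_intros)
      qed simp
      then obtain c where c: "\<And>s. s \<in> {0..<T} \<Longrightarrow> \<tau> (y s) - s = c"
        by blast
      then have "\<tau> (y t) - t = \<tau> (y 0) - 0"
        using c[of 0] c[OF t] T by simp
      then have "\<tau> (y t) = t"
        using y0 \<tau>0 by simp
      then show ?thesis
        using g\<tau>[of "y t"] y[OF t] by simp
    qed
  qed
qed

section \<open>Positivity of the quadratic form\<close>

text \<open>The quadratic form \<open>C h\<^sup>2 - 2 \<lambda> u\<^sub>0' h k + k\<^sup>2\<close>, the homogenization of \<open>\<Q>\<close>, at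
  \<open>(h, k) = (sin \<theta>, cos \<theta>)\<close>. The pair \<open>z\<close> stands for \<open>(u\<^sub>0', \<rho>\<^sub>0)\<close>; it is kept
  as a variable because positivity is needed on a closed set of such pairs, not only on
  those that are attained.\<close>

definition ghs_form :: "real \<Rightarrow> real \<Rightarrow> real \<Rightarrow> real \<times> real \<Rightarrow> real" where
  "ghs_form lam kap \<theta> z =
     lam * (lam * (fst z)\<^sup>2 - kap * (snd z)\<^sup>2) * (sin \<theta>)\<^sup>2 -
     2 * lam * fst z * sin \<theta> * cos \<theta> + (cos \<theta>)\<^sup>2"

lemma ghs_form_sum_of_squares:
  "ghs_form lam kap \<theta> (d, r) = (cos \<theta> - lam * d * sin \<theta>)\<^sup>2 + - (lam * kap) * (r * sin \<theta>)\<^sup>2"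
  unfolding ghs_form_def by (simp add: power2_eq_square algebra_simps)

text \<open>If the second square vanishes with \<open>sin \<theta> \<noteq> 0\<close>, then \<open>r = 0\<close> and \<open>\<lambda> d < 0\<close>. As the sine and
  cosine are nonnegative on this quarter circle, that sign keeps the first square positive. At
  \<open>\<theta> = 0\<close> the form is \<open>1\<close> whatever the data.\<close>

lemma ghs_form_pos:
  assumes lk: "lam * kap < 0" and \<theta>: "\<theta> \<in> {0..pi/2}" and dr: "r \<noteq> 0 \<or> lam * d < 0"
  shows "0 < ghs_form lam kap \<theta> (d, r)"
proof -
  have s0: "0 \<le> sin \<theta>" and c0: "0 \<le> cos \<theta>"
    using \<theta> pi_gt_zero by (auto intro: sin_ge_zero cos_ge_zero)
  consider "r * sin \<theta> \<noteq> 0" | "sin \<theta> = 0" | "sin \<theta> > 0" "lam * d < 0"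
    using dr s0 by force
  then show ?thesis
  proof cases
    case 1
    then have "0 < - (lam * kap) * (r * sin \<theta>)\<^sup>2"
      using lk by (intro mult_pos_pos) auto
    then show ?thesis
      unfolding ghs_form_sum_of_squares by (intro add_nonneg_pos) auto
  next
    case 2
    then show ?thesis
      using sin_cos_squared_add[of \<theta>] by (simp add: ghs_form_def)
  next
    case 3
    then have "0 < cos \<theta> - lam * d * sin \<theta>"
      using c0 by (smt (verit) mult_neg_pos)
    moreover have "0 \<le> - (lam * kap) * (r * sin \<theta>)\<^sup>2"
      using lk by (intro mult_nonneg_nonneg) auto
    ultimately show ?thesis
      unfolding ghs_form_sum_of_squares by (intro add_pos_nonneg) auto
  qed
qed

text \<open>The set \<open>K\<close> consists of the joint limit values of the data. Joint ones are necessary: whether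
  \<open>C\<close> vanishes in the limit depends on \<open>u\<^sub>0'\<close> and \<open>\<rho>\<^sub>0\<close> along one and the same
  sequence of points. A triple in the closure of the joint graph projects to limit values of
  \<open>u\<^sub>0'\<close>, \<open>\<rho>\<^sub>0\<close> and \<open>C\<close>, to which the hypotheses apply. Where \<open>\<rho>\<^sub>0\<close> tends to zero,
  they give \<open>\<lambda> v \<le> 0\<close> and \<open>\<lambda>\<^sup>2 v\<^sup>2 \<noteq> 0\<close>, which is \<open>\<lambda> v < 0\<close>.\<close>

lemma ghs_form_compact_range:
  fixes lam kap :: real
  assumes lk: "lam * kap < 0"
    and bd: "bounded (du0 ` {0..1})" and br: "bounded (rho0 ` {0..1})"
    and zero: "\<And>a v. a \<in> {0..1} \<Longrightarrow> 0 \<in> limit_values rho0 a \<Longrightarrow> v \<in> limit_values du0 a \<Longrightarrow> lam * v \<le> 0"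
    and C: "\<And>a. a \<in> {0..1} \<Longrightarrow> 0 \<in> limit_values rho0 a \<Longrightarrow>
      0 \<notin> limit_values (ghs_C lam kap du0 rho0) a"
  obtains K where "compact K" "\<And>x. x \<in> {0..1} \<Longrightarrow> (du0 x, rho0 x) \<in> K"
    and "\<And>\<theta> z. \<theta> \<in> {0..pi/2} \<Longrightarrow> z \<in> K \<Longrightarrow> 0 < ghs_form lam kap \<theta> z"
proof
  define G where "G = closure ((\<lambda>x. (x, du0 x, rho0 x)) ` {0..1})"
  have G_image: "h p \<in> closure ((\<lambda>x. h (x, du0 x, rho0 x)) ` {0..1})"
    if "p \<in> G" "continuous_on UNIV h" for p and h :: "real \<times> real \<times> real \<Rightarrow> real \<times> real"
    using image_closure_subset[of "(\<lambda>x. (x, du0 x, rho0 x)) ` {0..1}" h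
        "closure ((\<lambda>x. h (x, du0 x, rho0 x)) ` {0..1})"] that closure_subset
    unfolding G_def by (fastforce simp: image_image intro: continuous_on_subset)
  have "bounded ({0..1::real} \<times> du0 ` {0..1} \<times> rho0 ` {0..1})"
    using bd br by (intro bounded_Times bounded_closed_interval)
  then have "bounded ((\<lambda>x. (x, du0 x, rho0 x)) ` {0..1})"
    by (rule bounded_subset) auto
  then have "compact G"
    unfolding G_def by (simp add: compact_closure)
  then show "compact (snd ` G)"
    by (intro compact_continuous_image continuous_intros)
  show "(du0 x, rho0 x) \<in> snd ` G" if "x \<in> {0..1}" for x
    using that closure_subset[of "(\<lambda>x. (x, du0 x, rho0 x)) ` {0..1}"]
    unfolding G_def by (intro image_eqI[of _ snd "(x, du0 x, rho0 x)"]) auto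
  show "0 < ghs_form lam kap \<theta> z" if \<theta>: "\<theta> \<in> {0..pi/2}" and zG: "z \<in> snd ` G" for \<theta> z
  proof -
    obtain a d r where z: "z = (d, r)" and G: "(a, d, r) \<in> G"
      using zG by auto
    have "G \<subseteq> {0..1} \<times> UNIV"
      unfolding G_def by (rule closure_minimal) (auto intro: closed_Times)
    then have a: "a \<in> {0..1}"
      using G by auto
    have d: "d \<in> limit_values du0 a"
      using G_image[OF G, of "\<lambda>p. (fst p, fst (snd p))"]
      by (simp add: limit_values_def continuous_intros)
    have r: "r \<in> limit_values rho0 a"
      using G_image[OF G, of "\<lambda>p. (fst p, snd (snd p))"]
      by (simp add: limit_values_def continuous_intros)
    have c: "lam * (lam * d\<^sup>2 - kap * r\<^sup>2) \<in> limit_values (ghs_C lam kap du0 rho0) a"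
      using G_image[OF G, of "\<lambda>p. (fst p,
        lam * (lam * (fst (snd p))\<^sup>2 - kap * (snd (snd p))\<^sup>2))"]
      by (simp add: limit_values_def ghs_C_def continuous_intros)
    have "lam * d < 0" if "r = 0"
    proof -
      have "lam * d \<noteq> 0"
        using C[OF a] c r that by auto
      then show ?thesis
        using zero[OF a _ d] r that by (simp add: less_le)
    qed
    then show ?thesis
      unfolding z using ghs_form_pos[OF lk \<theta>] by blast
  qed
qed

section \<open>The representation formulas in the angle\<close>

text \<open>The sign conditions on the data enter the limit process through the positivity of the form on
  a compact set, which is the conclusion of \<open>ghs_form_compact_range\<close>.\<close>

locale ghs_angular =
  fixes lam kap :: real and du0 rho0 :: "real \<Rightarrow> real" and K :: "(real \<times> real) set"
  assumes lam: "lam \<noteq> 0"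
    and du0: "bounded_ae_continuous du0" and rho0: "bounded_ae_continuous rho0"
    and K: "compact K" and range: "\<And>x. x \<in> {0..1} \<Longrightarrow> (du0 x, rho0 x) \<in> K"
    and pos: "\<And>\<theta> z. \<theta> \<in> {0..pi/2} \<Longrightarrow> z \<in> K \<Longrightarrow> 0 < ghs_form lam kap \<theta> z"
begin

abbreviation "C \<equiv> ghs_C lam kap du0 rho0"

abbreviation "R \<theta> x \<equiv> ghs_form lam kap \<theta> (du0 x, rho0 x)"

text \<open>\<open>J\<close> is \<open>\<P>\<^sub>0\<close> without its power of \<open>cos \<theta>\<close>, and it has the limit \<open>\<M>\<close> at \<open>\<pi>/2\<close>. \<open>L\<close> is what the
  integral in the formula for \<open>u\<^sub>x\<close> contributes once the divergent constant has cancelled; its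
  limit is \<open>- \<lambda> \<N>\<close>.\<close>

definition J :: "real \<Rightarrow> real" where
  "J \<theta> = integral {0..1} (\<lambda>x. R \<theta> x powr (- (1 / (2 * lam))))"

definition L :: "real \<Rightarrow> real" where
  "L \<theta> = integral {0..1} (\<lambda>x. (cos \<theta> - lam * du0 x * sin \<theta>) / R \<theta> x powr (1 + 1 / (2 * lam)))"

lemma R_pos: "\<theta> \<in> {0..pi/2} \<Longrightarrow> x \<in> {0..1} \<Longrightarrow> 0 < R \<theta> x"
  using pos range by blast

lemma continuous_on_form: "continuous_on A (\<lambda>(\<theta>, z). ghs_form lam kap \<theta> z)"
  unfolding ghs_form_def case_prod_unfold by (intro continuous_intros)

lemma continuous_on_weight: "continuous_on ({0..pi/2} \<times> K) (\<lambda>(\<theta>, z). ghs_form lam kap \<theta> z powr p)"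
  using continuous_on_powr[OF continuous_on_form[of "{0..pi/2} \<times> K"] continuous_on_const[of _ p]] pos
  by (force simp: case_prod_unfold)

lemma continuous_on_numerator_weight:
  "continuous_on ({0..pi/2} \<times> K)
     (\<lambda>(\<theta>, z). (cos \<theta> - lam * fst z * sin \<theta>) / ghs_form lam kap \<theta> z powr p)"
  using continuous_on_divide[OF _ continuous_on_weight[of p], of "\<lambda>(\<theta>, z). cos \<theta> - lam * fst z * sin \<theta>"] pos
  by (force simp: case_prod_unfold intro!: continuous_intros)

lemma absolutely_integrable_section:
  fixes \<Phi> :: "real \<Rightarrow> real \<times> real \<Rightarrow> real"
  assumes "continuous_on ({0..pi/2} \<times> K) (\<lambda>(\<theta>, z). \<Phi> \<theta> z)" "\<theta> \<in> {0..pi/2}"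
  shows "(\<lambda>x. \<Phi> \<theta> (du0 x, rho0 x)) absolutely_integrable_on {0..1}"
proof -
  have "continuous_on K (\<Phi> \<theta>)"
    using continuous_on_compose2[OF assms(1), of K "\<lambda>z. (\<theta>, z)"] assms(2)
    by (force intro!: continuous_intros)
  then show ?thesis
    using du0 rho0 K range
    by (intro bounded_ae_continuous_absolutely_integrable bounded_ae_continuous_compose)
qed

lemmas J_absolutely_integrable =
  absolutely_integrable_section[OF continuous_on_weight[of "- (1 / (2 * lam))"]]

lemmas L_absolutely_integrable =
  absolutely_integrable_section[OF continuous_on_numerator_weight[of "1 + 1 / (2 * lam)"], simplified fst_conv]

lemma continuous_on_J: "continuous_on {0..pi/2} J"
  unfolding J_def
  using continuous_on_integral_compose[OF du0 rho0 K range continuous_on_weight compact_Icc] .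

lemma continuous_on_L: "continuous_on {0..pi/2} L"
  unfolding L_def
  using continuous_on_integral_compose[OF du0 rho0 K range continuous_on_numerator_weight compact_Icc]
  by simp

lemma J_pos:
  assumes \<theta>: "\<theta> \<in> {0..pi/2}"
  shows "0 < J \<theta>"
proof -
  let ?w = "\<lambda>z. ghs_form lam kap \<theta> z powr (- (1 / (2 * lam)))"
  \<comment> \<open>The minimum over \<open>K\<close> bounds the integrand away from zero, uniformly in \<open>x\<close>.\<close>
  have "continuous_on K ?w"
    using continuous_on_compose2[OF continuous_on_weight[of "- (1 / (2 * lam))"], of K "\<lambda>z. (\<theta>, z)"] \<theta>
    by (force intro!: continuous_intros)
  moreover have "K \<noteq> {}"
    using range[of 0] by auto
  ultimately obtain z where z: "z \<in> K" "\<And>y. y \<in> K \<Longrightarrow> ?w z \<le> ?w y"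
    using continuous_attains_inf[OF K] by blast
  have "0 < ?w z"
    using pos[OF \<theta> z(1)] by simp
  also have "?w z = integral {0..1} (\<lambda>_::real. ?w z)"
    by simp
  also have "\<dots> \<le> J \<theta>"
    unfolding J_def
    by (rule integral_le)
      (use z(2) range J_absolutely_integrable[OF \<theta>] in \<open>auto simp: absolutely_integrable_on_def\<close>)
  finally show ?thesis .
qed

lemma R_end: "R (pi/2) x = C x"
  by (simp add: ghs_form_def ghs_C_def)

lemma C_pos: "x \<in> {0..1} \<Longrightarrow> 0 < C x"
  using R_pos[of "pi/2" x] pi_gt_zero by (simp add: R_end)

lemma M_absolutely_integrable:
  "(\<lambda>x. 1 / C x powr (1 / (2 * lam))) absolutely_integrable_on {0..1}"
  using J_absolutely_integrable[of "pi/2"] pi_gt_zero by (simp add: R_end powr_minus_divide)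

lemma N_absolutely_integrable:
  "(\<lambda>x. du0 x / C x powr (1 + 1 / (2 * lam))) absolutely_integrable_on {0..1}"
proof -
  have "(\<lambda>x. (- 1 / lam) *\<^sub>R ((cos (pi/2) - lam * du0 x * sin (pi/2)) / R (pi/2) x powr (1 + 1 / (2 * lam))))
      absolutely_integrable_on {0..1}"
    using pi_gt_zero by (intro absolutely_integrable_scaleR_left L_absolutely_integrable) auto
  then show ?thesis
    using lam by (simp add: R_end)
qed

lemma J_end: "J (pi/2) = ghs_M lam kap du0 rho0"
  by (simp add: J_def R_end ghs_M_def powr_minus_divide)

lemma L_end: "L (pi/2) = - lam * ghs_N lam kap du0 rho0"
proof -
  have "L (pi/2) = integral {0..1} (\<lambda>x. (- lam) * (du0 x / C x powr (1 + 1 / (2 * lam))))"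
    by (simp add: L_def R_end)
  then show ?thesis
    by (simp only: integral_mult_right ghs_N_def)
qed

lemma Q_tan:
  assumes "cos \<theta> \<noteq> 0"
  shows "ghs_Q lam kap du0 rho0 (tan \<theta>) x = R \<theta> x / (cos \<theta>)\<^sup>2"
  using assms by (simp add: ghs_Q_def ghs_form_def ghs_C_def tan_def field_simps power2_eq_square)

lemma P0_tan:
  assumes \<theta>: "\<theta> \<in> {0..<pi/2}"
  shows "ghs_P0 lam kap du0 rho0 (tan \<theta>) = (cos \<theta>)\<^sup>2 powr (1 / (2 * lam)) * J \<theta>"
proof -
  have c: "0 < cos \<theta>"
    using \<theta> by (intro cos_gt_zero_pi) auto
  have "ghs_P0 lam kap du0 rho0 (tan \<theta>) =
      integral {0..1} (\<lambda>x. (cos \<theta>)\<^sup>2 powr (1 / (2 * lam)) * R \<theta> x powr (- (1 / (2 * lam))))"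
    unfolding ghs_P0_def
    by (rule integral_cong)
      (use c R_pos[of \<theta>] \<theta> in \<open>auto simp: Q_tan powr_divide less_imp_le powr_minus field_simps\<close>)
  then show ?thesis
    by (simp only: integral_mult_right J_def)
qed

lemma P0_powr_tan:
  assumes \<theta>: "\<theta> \<in> {0..<pi/2}"
  shows "ghs_P0 lam kap du0 rho0 (tan \<theta>) powr (- 2 * lam) = J \<theta> powr (- 2 * lam) / (cos \<theta>)\<^sup>2"
proof -
  have c: "0 < cos \<theta>"
    using \<theta> by (intro cos_gt_zero_pi) auto
  have J: "0 < J \<theta>"
    using \<theta> by (intro J_pos) auto
  have "ghs_P0 lam kap du0 rho0 (tan \<theta>) powr (- 2 * lam)
      = (cos \<theta>)\<^sup>2 powr (1 / (2 * lam) * (- 2 * lam)) * J \<theta> powr (- 2 * lam)"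
    unfolding P0_tan[OF \<theta>] using J by (simp only: powr_mult less_imp_le powr_ge_zero powr_powr)
  also have "1 / (2 * lam) * (- 2 * lam) = - 1"
    using lam by simp
  finally show ?thesis
    using c by (simp add: powr_minus_divide)
qed

lemma rho_char_tan:
  assumes \<theta>: "\<theta> \<in> {0..<pi/2}" and eta: "eta t = tan \<theta>"
  shows "ghs_rho_char lam kap du0 rho0 eta \<alpha> t = rho0 \<alpha> / R \<theta> \<alpha> * J \<theta> powr (- 2 * lam)"
proof -
  have "0 < cos \<theta>"
    using \<theta> by (intro cos_gt_zero_pi) auto
  then show ?thesis
    unfolding ghs_rho_char_def eta P0_powr_tan[OF \<theta>] by (simp add: Q_tan)
qed

text \<open>The identity
  \<open>sin \<theta> (\<lambda> u\<^sub>0' cos \<theta> - C sin \<theta>) = - R + cos \<theta> (cos \<theta> - \<lambda> u\<^sub>0' sin \<theta>)\<close>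
  splits the quotient in the formula into \<open>- cos \<theta> / sin \<theta>\<close>, which is free of \<open>\<alpha>\<close>, and
  a remainder with the factor \<open>cos\<^sup>2 \<theta>\<close>. The weighted mean reproduces the constant, so it drops out, and
  the factor \<open>cos\<^sup>2 \<theta>\<close> of the remainder cancels against the singular prefactor. The result is
  regular up to \<open>\<theta> = \<pi>/2\<close>; it is singular at \<open>\<theta> = 0\<close> instead, which does not affect the limit.\<close>

lemma ux_char_tan:
  assumes \<theta>: "\<theta> \<in> {0<..<pi/2}" and eta: "eta t = tan \<theta>" and \<alpha>: "\<alpha> \<in> {0..1}"
  shows "ghs_ux_char lam kap du0 rho0 eta \<alpha> t =
    J \<theta> powr (- 2 * lam) / (lam * sin \<theta>) *
      ((cos \<theta> - lam * du0 \<alpha> * sin \<theta>) / R \<theta> \<alpha> - L \<theta> / J \<theta>)"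
proof -
  define c s where "c = cos \<theta>" and "s = sin \<theta>"
  define q where "q = 1 / (2 * lam)"
  have \<theta>': "\<theta> \<in> {0..pi/2}" "\<theta> \<in> {0..<pi/2}"
    using \<theta> by auto
  have c: "0 < c"
    unfolding c_def using \<theta> by (intro cos_gt_zero_pi) auto
  have s: "0 < s"
    unfolding s_def using \<theta> by (intro sin_gt_zero) (auto intro: less_trans)
  have J: "0 < J \<theta>"
    using J_pos \<theta>' by blast
  let ?Q = "ghs_Q lam kap du0 rho0 (tan \<theta>)"
  have Q: "?Q x = R \<theta> x / c\<^sup>2" for x
    using Q_tan[of \<theta>] c by (simp add: c_def)
  have frac: "(lam * du0 x - tan \<theta> * C x) / ?Q x =
      - (c / s) + c\<^sup>2 / s * ((c - lam * du0 x * s) / R \<theta> x)" if x: "x \<in> {0..1}" for x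
  proof -
    have R: "R \<theta> x \<noteq> 0"
      using R_pos[OF \<theta>'(1) x] by simp
    have key: "s * (lam * du0 x * c - s * C x) = - R \<theta> x + c * (c - lam * du0 x * s)"
      by (simp add: ghs_form_def ghs_C_def c_def s_def algebra_simps power2_eq_square)
    have "(lam * du0 x - tan \<theta> * C x) / ?Q x = c * (lam * du0 x * c - s * C x) / R \<theta> x"
      unfolding Q unfolding tan_def c_def[symmetric] s_def[symmetric]
      using c R by (simp add: power2_eq_square field_simps)
    also have "\<dots> = c / s * (s * (lam * du0 x * c - s * C x)) / R \<theta> x"
      using s by simp
    also have "\<dots> = - (c / s) + c\<^sup>2 / s * ((c - lam * du0 x * s) / R \<theta> x)"
      unfolding key using R s by (simp add: field_simps power2_eq_square)
    finally show ?thesis .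
  qed
  have "integral {0..1} (\<lambda>x. (lam * du0 x - tan \<theta> * C x) / ?Q x powr (1 + q)) =
      integral {0..1} (\<lambda>x. c\<^sup>2 powr q * (- (c / s) * R \<theta> x powr (- q) +
        c\<^sup>2 / s * ((c - lam * du0 x * s) / R \<theta> x powr (1 + q))))"
  proof (rule integral_cong)
    fix x :: real assume x: "x \<in> {0..1}"
    have R: "0 < R \<theta> x"
      using R_pos[OF \<theta>'(1) x] .
    then have "0 < ?Q x"
      using c by (simp add: Q)
    then have "(lam * du0 x - tan \<theta> * C x) / ?Q x powr (1 + q) =
        (lam * du0 x - tan \<theta> * C x) / ?Q x * ?Q x powr (- q)"
      by (simp add: powr_add powr_minus field_simps)
    also have "?Q x powr (- q) = c\<^sup>2 powr q * R \<theta> x powr (- q)"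
      unfolding Q using R c by (simp add: powr_divide powr_minus field_simps)
    also have "(lam * du0 x - tan \<theta> * C x) / ?Q x * (c\<^sup>2 powr q * R \<theta> x powr (- q)) =
        c\<^sup>2 powr q * (- (c / s) * R \<theta> x powr (- q) +
        c\<^sup>2 / s * ((c - lam * du0 x * s) / R \<theta> x powr (1 + q)))"
      unfolding frac[OF x] using R by (simp add: powr_add powr_minus field_simps)
    finally show "(lam * du0 x - tan \<theta> * C x) / ?Q x powr (1 + q) =
        c\<^sup>2 powr q * (- (c / s) * R \<theta> x powr (- q) +
        c\<^sup>2 / s * ((c - lam * du0 x * s) / R \<theta> x powr (1 + q)))" .
  qed
  also have "\<dots> = c\<^sup>2 powr q * (- (c / s) * J \<theta> + c\<^sup>2 / s * L \<theta>)"
  proof (intro integral_unique has_integral_mult_right has_integral_add)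
    show "((\<lambda>x. R \<theta> x powr (- q)) has_integral J \<theta>) {0..1}"
      using J_absolutely_integrable[OF \<theta>'(1)]
      unfolding J_def q_def absolutely_integrable_on_def by (blast intro: integrable_integral)
    show "((\<lambda>x. (c - lam * du0 x * s) / R \<theta> x powr (1 + q)) has_integral L \<theta>) {0..1}"
      using L_absolutely_integrable[OF \<theta>'(1)]
      unfolding L_def q_def c_def s_def absolutely_integrable_on_def
      by (blast intro: integrable_integral)
  qed
  finally have int: "integral {0..1} (\<lambda>x. (lam * du0 x - tan \<theta> * C x) / ?Q x powr (1 + q)) =
      c\<^sup>2 powr q * (- (c / s) * J \<theta> + c\<^sup>2 / s * L \<theta>)" .
  have "ghs_ux_char lam kap du0 rho0 eta \<alpha> t = J \<theta> powr (- 2 * lam) / c\<^sup>2 / lam *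
      (- (c / s) + c\<^sup>2 / s * ((c - lam * du0 \<alpha> * s) / R \<theta> \<alpha>) -
       1 / (c\<^sup>2 powr q * J \<theta>) * (c\<^sup>2 powr q * (- (c / s) * J \<theta> + c\<^sup>2 / s * L \<theta>)))"
    unfolding ghs_ux_char_def Let_def eta P0_powr_tan[OF \<theta>'(2)] frac[OF \<alpha>]
    unfolding P0_tan[OF \<theta>'(2)] int[unfolded q_def] by (simp add: c_def q_def)
  also have "1 / (c\<^sup>2 powr q * J \<theta>) * (c\<^sup>2 powr q * (- (c / s) * J \<theta> + c\<^sup>2 / s * L \<theta>)) =
      - (c / s) + c\<^sup>2 / s * (L \<theta> / J \<theta>)"
    using c J by (simp add: field_simps)
  also have "- (c / s) + c\<^sup>2 / s * ((c - lam * du0 \<alpha> * s) / R \<theta> \<alpha>) - (- (c / s) + c\<^sup>2 / s * (L \<theta> / J \<theta>)) =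
      c\<^sup>2 / s * ((c - lam * du0 \<alpha> * s) / R \<theta> \<alpha> - L \<theta> / J \<theta>)"
    by (simp add: algebra_simps)
  finally show ?thesis
    using c s lam by (simp add: c_def s_def)
qed

section \<open>Convergence to the steady states\<close>

lemma char_tendsto_steady_state:
  assumes \<theta>: "(\<theta> \<longlongrightarrow> pi/2) (at_left T)"
    and near: "\<forall>\<^sub>F t in at_left T. \<theta> t \<in> {0<..<pi/2} \<and> eta t = tan (\<theta> t)"
    and \<alpha>: "\<alpha> \<in> {0..1}"
  shows "(ghs_ux_char lam kap du0 rho0 eta \<alpha> \<longlongrightarrow> ghs_U_inf lam kap du0 rho0 \<alpha>) (at_left T)"
    and "(ghs_rho_char lam kap du0 rho0 eta \<alpha> \<longlongrightarrow> ghs_P_inf lam kap du0 rho0 \<alpha>) (at_left T)"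
proof -
  let ?M = "ghs_M lam kap du0 rho0" and ?N = "ghs_N lam kap du0 rho0"
  have end_in: "pi/2 \<in> {0..pi/2}"
    using pi_gt_zero by auto
  have ev: "\<forall>\<^sub>F t in at_left T. \<theta> t \<in> {0..pi/2}"
    using near by (rule eventually_mono) auto
  have M: "0 < ?M"
    using J_pos[OF end_in] by (simp add: J_end)
  have C0: "0 < C \<alpha>"
    using C_pos[OF \<alpha>] .
  have tJ: "((\<lambda>t. J (\<theta> t)) \<longlongrightarrow> ?M) (at_left T)"
    using continuous_on_tendsto_compose[OF continuous_on_J \<theta> end_in ev] by (simp add: J_end)
  have tL: "((\<lambda>t. L (\<theta> t)) \<longlongrightarrow> - lam * ?N) (at_left T)"
    using continuous_on_tendsto_compose[OF continuous_on_L \<theta> end_in ev] by (simp add: L_end)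
  have tR: "((\<lambda>t. R (\<theta> t) \<alpha>) \<longlongrightarrow> C \<alpha>) (at_left T)"
    unfolding R_end[symmetric] ghs_form_def by (intro tendsto_intros \<theta>)
  have tp: "((\<lambda>t. J (\<theta> t) powr (- 2 * lam)) \<longlongrightarrow> ?M powr (- 2 * lam)) (at_left T)"
    using M by (intro tendsto_intros tJ) auto
  have "((\<lambda>t. rho0 \<alpha> / R (\<theta> t) \<alpha> * J (\<theta> t) powr (- 2 * lam)) \<longlongrightarrow>
      rho0 \<alpha> / C \<alpha> * ?M powr (- 2 * lam)) (at_left T)"
    using C0 by (intro tendsto_intros tR tp) auto
  moreover have "rho0 \<alpha> / C \<alpha> * ?M powr (- 2 * lam) = ghs_P_inf lam kap du0 rho0 \<alpha>"
    by (simp add: ghs_P_inf_def powr_minus_divide)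
  moreover have "\<forall>\<^sub>F t in at_left T. rho0 \<alpha> / R (\<theta> t) \<alpha> * J (\<theta> t) powr (- 2 * lam) =
      ghs_rho_char lam kap du0 rho0 eta \<alpha> t"
    using near by (rule eventually_mono) (subst rho_char_tan, auto)
  ultimately show "(ghs_rho_char lam kap du0 rho0 eta \<alpha> \<longlongrightarrow> ghs_P_inf lam kap du0 rho0 \<alpha>) (at_left T)"
    using Lim_transform_eventually by fastforce
  have "((\<lambda>t. J (\<theta> t) powr (- 2 * lam) / (lam * sin (\<theta> t)) *
        ((cos (\<theta> t) - lam * du0 \<alpha> * sin (\<theta> t)) / R (\<theta> t) \<alpha> - L (\<theta> t) / J (\<theta> t))) \<longlongrightarrow>
      ?M powr (- 2 * lam) / (lam * sin (pi/2)) *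
        ((cos (pi/2) - lam * du0 \<alpha> * sin (pi/2)) / C \<alpha> - (- lam * ?N) / ?M)) (at_left T)"
    using C0 M lam by (intro tendsto_intros tR tp tL tJ \<theta>) auto
  moreover have "?M powr (- 2 * lam) / (lam * sin (pi/2)) *
        ((cos (pi/2) - lam * du0 \<alpha> * sin (pi/2)) / C \<alpha> - (- lam * ?N) / ?M) =
      ghs_U_inf lam kap du0 rho0 \<alpha>"
    using C0 M lam
    by (auto simp: ghs_U_inf_def ghs_P_inf_def powr_minus_divide powr_add field_simps)
  moreover have "\<forall>\<^sub>F t in at_left T. J (\<theta> t) powr (- 2 * lam) / (lam * sin (\<theta> t)) *
        ((cos (\<theta> t) - lam * du0 \<alpha> * sin (\<theta> t)) / R (\<theta> t) \<alpha> - L (\<theta> t) / J (\<theta> t)) =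
      ghs_ux_char lam kap du0 rho0 eta \<alpha> t"
    using near by (rule eventually_mono) (subst ux_char_tan[OF _ _ \<alpha>], auto)
  ultimately show "(ghs_ux_char lam kap du0 rho0 eta \<alpha> \<longlongrightarrow> ghs_U_inf lam kap du0 rho0 \<alpha>) (at_left T)"
    using Lim_transform_eventually by fastforce
qed

text \<open>Since \<open>\<P>\<^sub>0(tan \<theta>)\<^sup>-\<^sup>2\<^sup>\<lambda> = J(\<theta>)\<^sup>-\<^sup>2\<^sup>\<lambda> / cos\<^sup>2 \<theta>\<close> and \<open>1 / cos\<^sup>2\<close> is the derivative of the tangent, \<open>\<eta> = tan \<theta>\<close>
  solves its equation exactly when \<open>\<theta>' = J(\<theta>)\<^sup>-\<^sup>2\<^sup>\<lambda>\<close>. Uniqueness of the angle makes every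
  admissible \<open>\<eta>\<close> on \<open>[0, T)\<close> the same function, so the limits hold for all of them.\<close>

lemma angle_clock:
  obtains \<theta> T where "0 < T" "(\<theta> \<longlongrightarrow> pi/2) (at_left T)"
    and "\<And>t. t \<in> {0<..<T} \<Longrightarrow> \<theta> t \<in> {0<..<pi/2}"
    and "ghs_eta lam kap du0 rho0 T (\<lambda>t. tan (\<theta> t))"
    and "\<And>eta t. ghs_eta lam kap du0 rho0 T eta \<Longrightarrow> t \<in> {0..<T} \<Longrightarrow> eta t = tan (\<theta> t)"
proof -
  let ?f = "\<lambda>x. J x powr (2 * lam)"
  have cont: "continuous_on {0..pi/2} ?f"
    using J_pos by (intro continuous_intros continuous_on_J) (metis less_irrefl)
  have fpos: "0 < ?f x" if "x \<in> {0..pi/2}" for x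
    using J_pos[OF that] by simp
  have pi2: "0 < pi/2"
    by simp
  obtain g T where T: "0 < T" and g0: "g 0 = 0" and gT: "g T = pi/2"
    and mono: "strict_mono_on {0..T} g"
    and g_in: "\<And>t. t \<in> {0..T} \<Longrightarrow> g t \<in> {0..pi/2}"
    and dg: "\<And>t. t \<in> {0..T} \<Longrightarrow> (g has_real_derivative inverse (?f (g t))) (at t within {0..T})"
    and unique: "\<And>y t. y 0 = 0 \<Longrightarrow> (\<And>s. s \<in> {0..<T} \<Longrightarrow> y s \<in> {0..pi/2} \<and>
          (y has_real_derivative inverse (?f (y s))) (at s within {0..<T})) \<Longrightarrow>
        t \<in> {0..<T} \<Longrightarrow> y t = g t"
    by (rule autonomous_flow_hits_end[OF pi2 cont fpos]) blast+
  have g_less: "g t < pi/2" if "t \<in> {0..<T}" for t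
    using strict_mono_onD[OF mono, of t T] that T gT by auto
  have speed: "ghs_P0 lam kap du0 rho0 (tan x) powr (- 2 * lam) = inverse (?f x) / (cos x)\<^sup>2"
    if "x \<in> {0..<pi/2}" for x
    unfolding P0_powr_tan[OF that] by (simp add: powr_minus)
  show thesis
  proof (rule that[where \<theta> = g and T = T])
    show "0 < T" by fact
    have "(g \<longlongrightarrow> g T) (at T within {0..T})"
      using DERIV_continuous[OF dg[of T]] T by (simp add: continuous_within)
    then show "(g \<longlongrightarrow> pi/2) (at_left T)"
      using at_within_Icc_at_left[OF T] gT by simp
    show "g t \<in> {0<..<pi/2}" if "t \<in> {0<..<T}" for t
      using strict_mono_onD[OF mono, of 0 t] g_less[of t] that g0 by auto
    show "ghs_eta lam kap du0 rho0 T (\<lambda>t. tan (g t))"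
      unfolding ghs_eta_def
    proof (intro conjI ballI)
      show "tan (g 0) = 0"
        by (simp add: g0)
      show "strict_mono_on {0..<T} (\<lambda>t. tan (g t))"
      proof (rule strict_mono_onI)
        fix r t assume rt: "r \<in> {0..<T}" "t \<in> {0..<T}" "r < t"
        then have "g r < g t"
          by (intro strict_mono_onD[OF mono]) auto
        then show "tan (g r) < tan (g t)"
          using g_in[of r] g_less[of t] rt by (intro tan_monotone) auto
      qed
      fix t assume t: "t \<in> {0..<T}"
      have gt: "g t \<in> {0..<pi/2}"
        using g_in[of t] g_less[of t] t by auto
      then have "0 < cos (g t)"
        by (intro cos_gt_zero_pi) auto
      then have "DERIV tan (g t) :> inverse ((cos (g t))\<^sup>2)"
        by (intro DERIV_tan) simp
      moreover have "(g has_real_derivative inverse (?f (g t))) (at t within {0..<T})"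
        by (rule DERIV_subset[OF dg]) (use t in auto)
      ultimately have "((\<lambda>t. tan (g t)) has_real_derivative
          inverse ((cos (g t))\<^sup>2) * inverse (?f (g t))) (at t within {0..<T})"
        by (intro DERIV_chain')
      then show "((\<lambda>t. tan (g t)) has_real_derivative
          ghs_P0 lam kap du0 rho0 (tan (g t)) powr (- 2 * lam)) (at t within {0..<T})"
        unfolding speed[OF gt] by (simp only: divide_inverse mult.commute)
    qed
    show "eta t = tan (g t)" if eta: "ghs_eta lam kap du0 rho0 T eta" and t: "t \<in> {0..<T}" for eta t
    proof -
      have eta0: "eta 0 = 0" and em: "strict_mono_on {0..<T} eta"
        and de: "\<And>t. t \<in> {0..<T} \<Longrightarrow> (eta has_real_derivative
          ghs_P0 lam kap du0 rho0 (eta t) powr (- 2 * lam)) (at t within {0..<T})"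
        using eta unfolding ghs_eta_def by auto
      have "arctan (eta t) = g t"
      proof (rule unique[of "\<lambda>t. arctan (eta t)", OF _ _ t])
        show "arctan (eta 0) = 0"
          by (simp add: eta0)
        fix s assume s: "s \<in> {0..<T}"
        have "0 \<le> eta s"
          using strict_mono_onD[OF em, of 0 s] s eta0 by (cases "s = 0") auto
        then have in_dom: "arctan (eta s) \<in> {0..<pi/2}"
          using arctan_ubound by auto
        have "((\<lambda>t. arctan (eta t)) has_real_derivative inverse (1 + (eta s)\<^sup>2) *
            ghs_P0 lam kap du0 rho0 (eta s) powr (- 2 * lam)) (at s within {0..<T})"
          by (rule DERIV_chain'[OF de[OF s] DERIV_arctan])
        moreover have "inverse (1 + (eta s)\<^sup>2) * ghs_P0 lam kap du0 rho0 (eta s) powr (- 2 * lam) =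
            inverse (?f (arctan (eta s)))"
        proof -
          have "1 + (eta s)\<^sup>2 = inverse ((cos (arctan (eta s)))\<^sup>2)"
            using tan_sec[of "arctan (eta s)"] by (simp add: tan_arctan power_inverse)
          then show ?thesis
            using speed[OF in_dom] by (simp add: tan_arctan)
        qed
        ultimately show "arctan (eta s) \<in> {0..pi/2} \<and> ((\<lambda>t. arctan (eta t)) has_real_derivative
            inverse (?f (arctan (eta s)))) (at s within {0..<T})"
          using in_dom by auto
      qed
      then show ?thesis
        by (metis tan_arctan)
    qed
  qed
qed

end

theorem theorem4p24:
  fixes lam kap :: real and u0 du0 rho0 :: "real \<Rightarrow> real"
  assumes "lam * kap < 0"
    and "ghs_data u0 du0 rho0"
    and "(\<forall>a\<in>{0..1}. 0 \<notin> limit_values rho0 a) \<or>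
         (finite {a\<in>{0..1}. 0 \<in> limit_values rho0 a} \<and>
          (\<forall>a\<in>{0..1}. 0 \<in> limit_values rho0 a \<longrightarrow> (\<forall>v\<in>limit_values du0 a. lam * v \<le> 0)) \<and>
          (\<forall>a\<in>{0..1}. \<forall>c\<in>limit_values (ghs_C lam kap du0 rho0) a. 0 < c))"
  shows "(\<forall>\<alpha>\<in>{0..1}. 0 < ghs_C lam kap du0 rho0 \<alpha>) \<and>
    (\<lambda>\<alpha>. 1 / ghs_C lam kap du0 rho0 \<alpha> powr (1 / (2 * lam))) absolutely_integrable_on {0..1} \<and>
    (\<lambda>\<alpha>. du0 \<alpha> / ghs_C lam kap du0 rho0 \<alpha> powr (1 + 1 / (2 * lam)))
      absolutely_integrable_on {0..1} \<and>
    0 < ghs_M lam kap du0 rho0 \<and>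
    (\<exists>t_inf>0.
       (\<exists>eta. ghs_eta lam kap du0 rho0 t_inf eta) \<and>
       (\<forall>eta. ghs_eta lam kap du0 rho0 t_inf eta \<longrightarrow>
          (\<forall>\<alpha>\<in>{0..1}.
             ((\<lambda>t. ghs_ux_char lam kap du0 rho0 eta \<alpha> t)
                \<longlongrightarrow> ghs_U_inf lam kap du0 rho0 \<alpha>) (at_left t_inf) \<and>
             ((\<lambda>t. ghs_rho_char lam kap du0 rho0 eta \<alpha> t)
                \<longlongrightarrow> ghs_P_inf lam kap du0 rho0 \<alpha>) (at_left t_inf))) \<and>
       (\<forall>u ux rho gamma. ghs_solution lam kap u0 du0 rho0 t_inf u ux rho gamma \<longrightarrow>
          (\<forall>\<alpha>\<in>{0..1}.
             ((\<lambda>t. ux (gamma \<alpha> t) t)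
                \<longlongrightarrow> ghs_U_inf lam kap du0 rho0 \<alpha>) (at_left t_inf) \<and>
             ((\<lambda>t. rho (gamma \<alpha> t) t)
                \<longlongrightarrow> ghs_P_inf lam kap du0 rho0 \<alpha>) (at_left t_inf))))"
proof -
  let ?C = "ghs_C lam kap du0 rho0"
  have data: "bounded_ae_continuous du0" "bounded_ae_continuous rho0"
    using assms(2) unfolding ghs_data_def by auto
  have zero: "lam * v \<le> 0"
    if "a \<in> {0..1}" "0 \<in> limit_values rho0 a" "v \<in> limit_values du0 a" for a v
    using assms(3) that by blast
  have C: "0 \<notin> limit_values ?C a" if "a \<in> {0..1}" "0 \<in> limit_values rho0 a" for a
    using assms(3) that by (metis less_irrefl)
  have bd: "bounded (du0 ` {0..1})" and br: "bounded (rho0 ` {0..1})"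
    using data unfolding bounded_ae_continuous_def by auto
  obtain K where K: "compact K" "\<And>x. x \<in> {0..1} \<Longrightarrow> (du0 x, rho0 x) \<in> K"
    and pos: "\<And>\<theta> z. \<theta> \<in> {0..pi/2} \<Longrightarrow> z \<in> K \<Longrightarrow> 0 < ghs_form lam kap \<theta> z"
    by (rule ghs_form_compact_range[OF assms(1) bd br]) (erule (2) zero, erule (1) C, rule that, blast+)
  interpret ghs_angular lam kap du0 rho0 K
    using assms(1) data K pos by unfold_locales auto
  obtain \<theta> T where T: "0 < T" and \<theta>: "(\<theta> \<longlongrightarrow> pi/2) (at_left T)"
    and \<theta>_in: "\<And>t. t \<in> {0<..<T} \<Longrightarrow> \<theta> t \<in> {0<..<pi/2}"
    and ex: "ghs_eta lam kap du0 rho0 T (\<lambda>t. tan (\<theta> t))"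
    and unique: "\<And>eta t. ghs_eta lam kap du0 rho0 T eta \<Longrightarrow> t \<in> {0..<T} \<Longrightarrow> eta t = tan (\<theta> t)"
    by (rule angle_clock) (rule that, blast+)
  have near: "\<forall>\<^sub>F t in at_left T. t \<in> {0<..<T}"
    using eventually_at_left_real[OF T] .
  have lim: "(ghs_ux_char lam kap du0 rho0 eta \<alpha> \<longlongrightarrow> ghs_U_inf lam kap du0 rho0 \<alpha>) (at_left T) \<and>
      (ghs_rho_char lam kap du0 rho0 eta \<alpha> \<longlongrightarrow> ghs_P_inf lam kap du0 rho0 \<alpha>) (at_left T)"
    if eta: "ghs_eta lam kap du0 rho0 T eta" and \<alpha>: "\<alpha> \<in> {0..1}" for eta \<alpha>
  proof -
    have "\<forall>\<^sub>F t in at_left T. \<theta> t \<in> {0<..<pi/2} \<and> eta t = tan (\<theta> t)"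
      using near by (rule eventually_mono) (use \<theta>_in unique[OF eta] in auto)
    then show ?thesis
      using char_tendsto_steady_state[OF \<theta> _ \<alpha>] by blast
  qed
  have sol: "((\<lambda>t. ux (gamma \<alpha> t) t) \<longlongrightarrow> ghs_U_inf lam kap du0 rho0 \<alpha>) (at_left T) \<and>
      ((\<lambda>t. rho (gamma \<alpha> t) t) \<longlongrightarrow> ghs_P_inf lam kap du0 rho0 \<alpha>) (at_left T)"
    if sol: "ghs_solution lam kap u0 du0 rho0 T u ux rho gamma" and \<alpha>: "\<alpha> \<in> {0..1}"
    for u ux rho gamma \<alpha>
  proof -
    obtain eta where eta: "ghs_eta lam kap du0 rho0 T eta"
      and eq: "\<And>t. t \<in> {0..<T} \<Longrightarrow> ghs_ux_char lam kap du0 rho0 eta \<alpha> t = ux (gamma \<alpha> t) t"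
        "\<And>t. t \<in> {0..<T} \<Longrightarrow> ghs_rho_char lam kap du0 rho0 eta \<alpha> t = rho (gamma \<alpha> t) t"
      using sol \<alpha> unfolding ghs_solution_def by metis
    have "\<forall>\<^sub>F t in at_left T. ghs_ux_char lam kap du0 rho0 eta \<alpha> t = ux (gamma \<alpha> t) t"
      and "\<forall>\<^sub>F t in at_left T. ghs_rho_char lam kap du0 rho0 eta \<alpha> t = rho (gamma \<alpha> t) t"
      using near by (rule eventually_mono, use eq in auto)+
    then show ?thesis
      using lim[OF eta \<alpha>] by (blast intro: Lim_transform_eventually)
  qed
  have "0 < ghs_M lam kap du0 rho0"
    using J_pos[of "pi/2"] pi_gt_zero by (simp add: J_end)
  then show ?thesis
    using T ex lim sol C_pos M_absolutely_integrable N_absolutely_integrable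
    by (intro conjI exI[of _ T] ballI allI impI) blast+
qed

end
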